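(* Let $D(t)$ be the direction process defined in the context, with Poisson rate $\lambda$ and turning probabilities $p$ (counterclockwise), $q$ (clockwise), $1-p-q$ (reflection), and let $T(t)=\int_0^t\mathbf{1}_{\{D(\tau)\in\{d_1,d_3\}\}}\,d\tau$, $t>0$, be the time spent moving vertically up to time $t$. The characteristic function of $T(t)$ (with argument $\alpha$) is $$\begin{aligned}\mathbb{E}\left[e^{i\alpha T(t)}\right]=&\frac12\left(1+\frac{2\lambda(p+q)}{\sqrt{4\lambda^2(p+q)^2-\alpha^2}}\right)e^{\,i\frac{\alpha}{2}t-\lambda(p+q)t+\frac12\sqrt{4\lambda^2(p+q)^2-\alpha^2}\;t}\\&+\frac12\left(1-\frac{2\lambda(p+q)}{\sqrt{4\lambda^2(p+q)^2-\alpha^2}}\right)e^{\,i\frac{\alpha}{2}t-\lambda(p+q)t-\frac12\sqrt{4\lambda^2(p+q)^2-\alpha^2}\;t}.\end{aligned}$$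
   Context: Model. Let $d_j=(\cos(\pi j/2),\sin(\pi j/2))$, with index $j$ taken modulo 4. Let $N(t)$ be a homogeneous Poisson process of rate $\lambda$. The direction process $D(t)$ takes values in $\{d_0,d_1,d_2,d_3\}$; $D(0)$ is uniformly distributed; $D$ is constant between Poisson events; at each Poisson event $D$ jumps from its current value $d_j$ to $d_{j+1}$ with probability $p$ (counterclockwise turn), to $d_{j-1}$ with probability $q$ (clockwise turn), and to $d_{j+2}$ with probability $1-p-q$ (reflection); the initial direction, the Poisson process and the successive choices of turn are independent. The underlying planar motion, of speed $c$, is $(X(t),Y(t))=c\int_0^t D(\tau)\,d\tau$. Square roots of negative real numbers are complex square roots. *)

theory Defs
  imports "HOL-Probability.Probability"
begin

text \<open>The process is indexed by times \<open>t \<ge> 0\<close>; values at negative times are irrelevant.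
  In the conditions on increments the subtraction on \<^typ>\<open>nat\<close> is genuine because the paths are
  monotone.\<close>

locale poisson_process = prob_space M
  for M :: "'a measure" and rate :: real and N :: "real \<Rightarrow> 'a \<Rightarrow> nat" +
  assumes rate_pos: "0 < rate"
    and measurable_N: "\<And>t. 0 \<le> t \<Longrightarrow> N t \<in> measurable M (count_space UNIV)"
    and N_zero: "\<And>\<omega>. \<omega> \<in> space M \<Longrightarrow> N 0 \<omega> = 0"
    and N_mono: "\<And>\<omega>. \<omega> \<in> space M \<Longrightarrow> mono_on {0..} (\<lambda>t. N t \<omega>)"
    and N_right_continuous:
      "\<And>\<omega> t. \<omega> \<in> space M \<Longrightarrow> 0 \<le> t \<Longrightarrow> continuous (at_right t) (\<lambda>s. N s \<omega>)"
    and N_indep_increments: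
      "\<And>(ts :: nat \<Rightarrow> real) n. 0 \<le> ts 0 \<Longrightarrow> mono_on {..n} ts \<Longrightarrow>
         indep_vars (\<lambda>_. count_space UNIV) (\<lambda>i \<omega>. N (ts (Suc i)) \<omega> - N (ts i) \<omega>) {..<n}"
    and N_poisson_increments:
      "\<And>s t. 0 \<le> s \<Longrightarrow> s < t \<Longrightarrow>
         distr M (count_space UNIV) (\<lambda>\<omega>. N t \<omega> - N s \<omega>) =
         measure_pmf (poisson_pmf (rate * (t - s)))"

text \<open>The formula is periodic in the index with period 4, so integer indices need no explicit
  reduction modulo 4.\<close>

definition dir :: "int \<Rightarrow> real \<times> real" where
  "dir j = (cos (pi * of_int j / 2), sin (pi * of_int j / 2))"

text \<open>\<open>J \<omega>\<close> is the index of the initial direction; \<open>\<xi> k \<omega>\<close> is the amount by which the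
  \<open>(k+1)\<close>-st Poisson event changes the index.\<close>

definition direction ::
    "(real \<Rightarrow> 'a \<Rightarrow> nat) \<Rightarrow> ('a \<Rightarrow> int) \<Rightarrow> (nat \<Rightarrow> 'a \<Rightarrow> int) \<Rightarrow> real \<Rightarrow> 'a \<Rightarrow> real \<times> real" where
  "direction N J \<xi> t \<omega> = dir (J \<omega> + (\<Sum>k<N t \<omega>. \<xi> k \<omega>))"

datatype noise_source = Initial | Clock | Turn nat

text \<open>The sigma-algebra generated by each source; \<open>Clock\<close> carries the whole path
  \<open>(N t)\<close>, \<open>t \<ge> 0\<close>.\<close>

fun source_algebra ::
    "'a measure \<Rightarrow> (real \<Rightarrow> 'a \<Rightarrow> nat) \<Rightarrow> ('a \<Rightarrow> int) \<Rightarrow> (nat \<Rightarrow> 'a \<Rightarrow> int) \<Rightarrow>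
     noise_source \<Rightarrow> 'a set set" where
  "source_algebra M N J \<xi> Initial = sets (vimage_algebra (space M) J (count_space UNIV))"
| "source_algebra M N J \<xi> Clock =
     sets (vimage_algebra (space M) (\<lambda>\<omega>. \<lambda>t\<in>{0..}. N t \<omega>) (PiM {0..} (\<lambda>_. count_space UNIV)))"
| "source_algebra M N J \<xi> (Turn k) = sets (vimage_algebra (space M) (\<xi> k) (count_space UNIV))"

locale direction_process = poisson_process M rate N
  for M :: "'a measure" and rate :: real and N :: "real \<Rightarrow> 'a \<Rightarrow> nat" +
  fixes p q :: real and J :: "'a \<Rightarrow> int" and \<xi> :: "nat \<Rightarrow> 'a \<Rightarrow> int"
  assumes turn_probs: "0 \<le> p" "0 \<le> q" "p + q \<le> 1"
    and measurable_J: "J \<in> measurable M (count_space UNIV)"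
    and J_uniform: "distr M (count_space UNIV) J = measure_pmf (pmf_of_set {0, 1, 2, 3})"
    and measurable_turn: "\<And>k. \<xi> k \<in> measurable M (count_space UNIV)"
    and turn_counterclockwise: "\<And>k. prob {\<omega> \<in> space M. \<xi> k \<omega> = 1} = p"
    and turn_clockwise: "\<And>k. prob {\<omega> \<in> space M. \<xi> k \<omega> = -1} = q"
    and turn_reflection: "\<And>k. prob {\<omega> \<in> space M. \<xi> k \<omega> = 2} = 1 - p - q"
    and indep_sources: "indep_sets (source_algebra M N J \<xi>) UNIV"

definition vertical_time ::
    "(real \<Rightarrow> 'a \<Rightarrow> nat) \<Rightarrow> ('a \<Rightarrow> int) \<Rightarrow> (nat \<Rightarrow> 'a \<Rightarrow> int) \<Rightarrow> real \<Rightarrow> 'a \<Rightarrow> real" where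
  "vertical_time N J \<xi> t \<omega> =
     (LBINT \<tau>:{0..t}. indicator {dir 1, dir 3} (direction N J \<xi> \<tau> \<omega>))"

end

theory Submission
  imports Defs
begin

text \<open>Let \<open>S(t)\<close> be \<open>1\<close> if the motion is horizontal and \<open>-1\<close> if it is vertical. Reflections do not change
  \<open>S\<close>, turns flip it, so \<open>S\<close> is a telegraph signal with flip rate \<open>\<mu> = \<lambda> (p + q)\<close> and
  \<open>T(t) = t/2 - 1/2 \<integral> S\<close>. With \<open>\<beta> = - \<alpha>/2\<close>, \<open>h = t/n\<close> and \<open>Z\<^sub>k = exp (\<i> \<beta> h (S(0) + \<dots> + S((k-1)h)))\<close>,
  the Markov property gives a linear recursion for \<open>u\<^sub>k = E Z\<^sub>k\<close> and \<open>w\<^sub>k = E (Z\<^sub>k S(kh))\<close>. If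
  \<open>\<kappa>\<^sup>2 + 2 \<mu> \<kappa> + \<beta>\<^sup>2 = 0\<close>, then \<open>(\<i> \<beta>, \<kappa>)\<close> is a left eigenvector of the limiting generator, so
  \<open>\<i> \<beta> u\<^sub>n + \<kappa> w\<^sub>n\<close> tends to \<open>\<i> \<beta> exp (\<kappa> t)\<close>; the two roots \<open>\<kappa>\<close> determine the limit of \<open>u\<^sub>n\<close>.\<close>

section \<open>Independence and Poisson increments\<close>

text \<open>Independence makes the joint law the product of the marginals, and boundedness gives
  Fubini. Averaging over an independent copy of \<open>Y\<close> with \<open>X\<close> frozen stands
  in for conditioning on \<open>X\<close>.\<close>

lemma (in prob_space) indep_var_integral_iterated:
  fixes f :: "'b \<Rightarrow> 'b \<Rightarrow> 'd::{banach, second_countable_topology}"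
  assumes ind: "indep_var S X T Y"
    and meas: "case_prod f \<in> borel_measurable (S \<Otimes>\<^sub>M T)"
    and bound: "\<And>x y. norm (f x y) \<le> B"
  shows "(LINT \<omega>|M. f (X \<omega>) (Y \<omega>)) = (LINT \<omega>|M. LINT \<omega>'|M. f (X \<omega>) (Y \<omega>'))"
proof -
  have X: "X \<in> measurable M S" and Y: "Y \<in> measurable M T"
    using ind by (auto dest: indep_var_rv1 indep_var_rv2)
  have eq: "distr M S X \<Otimes>\<^sub>M distr M T Y = distr M (S \<Otimes>\<^sub>M T) (\<lambda>\<omega>. (X \<omega>, Y \<omega>))"
    using ind by (simp add: indep_var_distribution_eq)
  interpret DX: prob_space "distr M S X" by (rule prob_space_distr) (rule X)
  interpret DY: prob_space "distr M T Y" by (rule prob_space_distr) (rule Y)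
  interpret P: pair_prob_space "distr M S X" "distr M T Y" ..
  have sets: "sets (distr M S X \<Otimes>\<^sub>M distr M T Y) = sets (S \<Otimes>\<^sub>M T)"
    by (intro sets_pair_measure_cong) simp_all
  have meas': "case_prod f \<in> borel_measurable (distr M S X \<Otimes>\<^sub>M distr M T Y)"
    using meas measurable_cong_sets[OF sets refl] by blast
  have int: "integrable (distr M S X \<Otimes>\<^sub>M distr M T Y) (case_prod f)"
    by (rule P.P.integrable_const_bound[of _ B])
      (use meas' bound in \<open>auto split: prod.splits\<close>)
  have "(LINT \<omega>|M. f (X \<omega>) (Y \<omega>)) = (LINT z|distr M (S \<Otimes>\<^sub>M T) (\<lambda>\<omega>. (X \<omega>, Y \<omega>)). case_prod f z)"
    by (subst integral_distr[OF _ meas]) (use X Y in \<open>auto intro: measurable_Pair\<close>)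
  also have "\<dots> = (LINT x|distr M S X. LINT y|distr M T Y. f x y)"
    unfolding eq[symmetric] using P.integral_fst'[OF int] by simp
  also have "\<dots> = (LINT \<omega>|M. LINT y|distr M T Y. f (X \<omega>) y)"
    by (intro integral_distr X DY.borel_measurable_lebesgue_integral) (use meas in measurable)
  also have "\<dots> = (LINT \<omega>|M. LINT \<omega>'|M. f (X \<omega>) (Y \<omega>'))"
  proof (rule Bochner_Integration.integral_cong[OF refl])
    fix \<omega> assume "\<omega> \<in> space M"
    then have "X \<omega> \<in> space S" using X by (auto dest: measurable_space)
    then have "(\<lambda>y. f (X \<omega>) y) \<in> borel_measurable T"
      using measurable_Pair2[OF meas] by simp
    then show "(LINT y|distr M T Y. f (X \<omega>) y) = (LINT \<omega>'|M. f (X \<omega>) (Y \<omega>'))"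
      by (intro integral_distr Y)
  qed
  finally show ?thesis .
qed

section \<open>Measurability of countably valued lists and sums\<close>

lemma measurable_map_count_space:
  fixes f :: "'i \<Rightarrow> 'b \<Rightarrow> 'c::countable"
  assumes "\<And>i. i \<in> set is \<Longrightarrow> f i \<in> measurable K (count_space UNIV)"
  shows "(\<lambda>x. map (\<lambda>i. f i x) is) \<in> measurable K (count_space UNIV)"
  using assms
proof (induction "is")
  case Nil
  then show ?case by simp
next
  case (Cons i "is")
  have 1: "f i \<in> measurable K (count_space UNIV)"
    and 2: "(\<lambda>x. map (\<lambda>i. f i x) is) \<in> measurable K (count_space UNIV)"
    using Cons by auto
  have "(\<lambda>x. f i x # map (\<lambda>i. f i x) is) \<in> measurable K (count_space UNIV)"
    by (rule measurable_compose_countable[OF _ 1, where f = "\<lambda>a x. a # map (\<lambda>i. f i x) is"])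
      (rule measurable_compose[OF 2], simp)
  then show ?case by simp
qed

lemma measurable_sum_count_space:
  fixes f :: "'i \<Rightarrow> 'b \<Rightarrow> 'c::{countable, comm_monoid_add}"
  assumes "\<And>i. i \<in> I \<Longrightarrow> f i \<in> measurable K (count_space UNIV)"
  shows "(\<lambda>x. \<Sum>i\<in>I. f i x) \<in> measurable K (count_space UNIV)"
  using assms
proof (induction I rule: infinite_finite_induct)
  case (insert i I)
  have 1: "f i \<in> measurable K (count_space UNIV)"
    and 2: "(\<lambda>x. \<Sum>i\<in>I. f i x) \<in> measurable K (count_space UNIV)"
    using insert by auto
  have "(\<lambda>x. f i x + (\<Sum>i\<in>I. f i x)) \<in> measurable K (count_space UNIV)"
    by (rule measurable_compose_countable[OF _ 1, where f = "\<lambda>a x. a + (\<Sum>i\<in>I. f i x)"])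
      (rule measurable_compose[OF 2], simp)
  then show ?case using insert.hyps by simp
qed simp_all

text \<open>This is the exponential series at \<open>a * z\<close>. The bound on \<open>z\<close>
  lets the probability masses dominate the terms, so the integral is the sum of the series; negative
  \<open>z\<close> is covered, as \<open>1 - 2 * (p + q)\<close> can be negative.\<close>

lemma poisson_pgf:
  fixes a z :: real
  assumes "0 < a" "\<bar>z\<bar> \<le> 1"
  shows "(LINT n|measure_pmf (poisson_pmf a). z ^ n) = exp (- a * (1 - z))"
proof -
  have s: "(\<lambda>n. (a * z) ^ n /\<^sub>R fact n) sums exp (a * z)" by (rule exp_converges)
  have eq: "pmf (poisson_pmf a) n * z ^ n = exp (- a) * ((a * z) ^ n /\<^sub>R fact n)" for n
    using assms by (simp add: power_mult_distrib divide_inverse)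
  have s2: "(\<lambda>n. pmf (poisson_pmf a) n * z ^ n) sums (exp (- a) * exp (a * z))"
    unfolding eq by (intro sums_mult s)
  have n: "integrable (count_space UNIV) (\<lambda>n. pmf (poisson_pmf a) n * z ^ n)"
  proof (rule Bochner_Integration.integrable_bound)
    show "integrable (count_space UNIV) (pmf (poisson_pmf a))" by (rule integrable_pmf)
    show "AE n in count_space UNIV. norm (pmf (poisson_pmf a) n * z ^ n) \<le> norm (pmf (poisson_pmf a) n)"
      using assms
      by (auto intro!: AE_I2 simp: abs_mult power_abs power_le_one mult_left_le simp del: pmf_poisson)
  qed simp
  have "(LINT n|measure_pmf (poisson_pmf a). z ^ n) = (LINT n|count_space UNIV. pmf (poisson_pmf a) n * z ^ n)"
    unfolding measure_pmf_eq_density by (subst integral_density) auto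
  also have "\<dots> = exp (- a) * exp (a * z)"
    using integral_count_space_nat[OF n] sums_unique[OF s2] by simp
  finally show ?thesis by (simp add: exp_add[symmetric] algebra_simps)
qed

section \<open>The Markov property of the telegraph signal\<close>

text \<open>\<open>True\<close> stands for an odd index or an odd turn, so this is the sign
  character of the parity.\<close>

definition flip_sign :: "bool \<Rightarrow> real" where
  "flip_sign b = (if b then - 1 else 1)"

lemma abs_flip_sign [simp]: "\<bar>flip_sign b\<bar> = 1"
  by (simp add: flip_sign_def)

lemma (in prob_space) expectation_flip_sign:
  assumes "Measurable.pred M P"
  shows "(LINT \<omega>|M. flip_sign (P \<omega>)) = 1 - 2 * prob {\<omega> \<in> space M. P \<omega>}"
proof -
  have E: "{\<omega> \<in> space M. P \<omega>} \<in> events" using assms by (simp add: pred_def)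
  have "(LINT \<omega>|M. flip_sign (P \<omega>)) = (LINT \<omega>|M. 1 - 2 * indicator {\<omega> \<in> space M. P \<omega>} \<omega>)"
    by (intro Bochner_Integration.integral_cong) (auto simp: flip_sign_def)
  also have "\<dots> = (LINT \<omega>|M. 1) - (LINT \<omega>|M. 2 * indicator {\<omega> \<in> space M. P \<omega>} \<omega>)"
    by (rule Bochner_Integration.integral_diff)
      (use E in \<open>auto intro!: integrable_mult_right integrable_real_indicator simp: less_top[symmetric]\<close>)
  also have "\<dots> = 1 - 2 * prob {\<omega> \<in> space M. P \<omega>}"
    using E by (simp add: prob_space)
  finally show ?thesis .
qed

context direction_process
begin

text \<open>Only the parity of the index separates vertical from horizontal motion. The argument
  counts events rather than time, so that for fixed \<open>m\<close> the value depends on the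
  initial direction and the turns but not on the clock.\<close>

definition vertical :: "nat \<Rightarrow> 'a \<Rightarrow> bool" where
  "vertical m \<omega> \<longleftrightarrow> odd (J \<omega> + (\<Sum>k<m. \<xi> k \<omega>))"

lemma measurable_vertical [measurable]: "vertical m \<in> measurable M (count_space UNIV)"
proof -
  have "(\<lambda>\<omega>. J \<omega> + (\<Sum>k<m. \<xi> k \<omega>)) \<in> measurable M (count_space UNIV)"
    by (rule measurable_compose_countable[OF _ measurable_J, where f = "\<lambda>j \<omega>. j + (\<Sum>k<m. \<xi> k \<omega>)"])
      (rule measurable_compose[OF measurable_sum_count_space[OF measurable_turn]], simp)
  then show ?thesis
    unfolding vertical_def[abs_def] by (rule measurable_compose) simp
qed

text \<open>\<^const>\<open>Clock\<close> is sampled at finitely many times so that all the sources take values in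
  one countable type, as \<^const>\<open>indep_vars\<close> requires a common type.\<close>

fun source_value :: "real list \<Rightarrow> noise_source \<Rightarrow> 'a \<Rightarrow> int list" where
  "source_value ts Initial \<omega> = [J \<omega>]"
| "source_value ts Clock \<omega> = map (\<lambda>t. int (N t \<omega>)) ts"
| "source_value ts (Turn k) \<omega> = [\<xi> k \<omega>]"

text \<open>Each value is a measurable function of its source, so it generates a smaller
  sigma-algebra and independence is inherited.\<close>

lemma indep_source_value:
  assumes ts: "\<And>t. t \<in> set ts \<Longrightarrow> 0 \<le> t"
  shows "indep_vars (\<lambda>_. count_space UNIV) (source_value ts) UNIV"
  unfolding indep_vars_def2
proof (intro conjI ballI)
  fix s
  show "random_variable (count_space UNIV) (source_value ts s)"
  proof (cases s)
    case Initial
    have "(\<lambda>\<omega>. [J \<omega>]) \<in> measurable M (count_space UNIV)"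
      by (rule measurable_compose[OF measurable_J]) simp
    with Initial show ?thesis by (simp cong: measurable_cong)
  next
    case (Turn k)
    have "(\<lambda>\<omega>. [\<xi> k \<omega>]) \<in> measurable M (count_space UNIV)"
      by (rule measurable_compose[OF measurable_turn[of k]]) simp
    with Turn show ?thesis by (simp cong: measurable_cong)
  next
    case Clock
    have "(\<lambda>\<omega>. map (\<lambda>t. int (N t \<omega>)) ts) \<in> measurable M (count_space UNIV)"
      by (rule measurable_map_count_space)
        (rule measurable_compose[OF measurable_N], use ts in auto)
    with Clock show ?thesis by (simp cong: measurable_cong)
  qed
next
  show "indep_sets (\<lambda>i. {source_value ts i -` A \<inter> space M |A. A \<in> sets (count_space UNIV)}) UNIV"
  proof (rule indep_sets_mono_sets[OF indep_sources])
    fix s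
    show "{source_value ts s -` A \<inter> space M |A. A \<in> sets (count_space UNIV)} \<subseteq> source_algebra M N J \<xi> s"
    proof (safe)
      fix A :: "int list set"
      show "source_value ts s -` A \<inter> space M \<in> source_algebra M N J \<xi> s"
      proof (cases s)
        case Initial
        have "J -` {j. [j] \<in> A} \<inter> space M \<in> source_algebra M N J \<xi> Initial"
          unfolding source_algebra.simps by (rule in_vimage_algebra) simp
        with Initial show ?thesis by (simp add: vimage_def)
      next
        case (Turn k)
        have "\<xi> k -` {j. [j] \<in> A} \<inter> space M \<in> source_algebra M N J \<xi> (Turn k)"
          unfolding source_algebra.simps by (rule in_vimage_algebra) simp
        with Turn show ?thesis by (simp add: vimage_def)
      next
        \<comment> \<open>The finite sample factors through the whole path by coordinate
          projections, so its preimage is pulled back in two stages. All sample times lie in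
          \<open>{0..}\<close>, where the restricted path agrees with \<open>N\<close>.\<close>
        case Clock
        let ?P = "PiM {0::real..} (\<lambda>_. count_space UNIV) :: (real \<Rightarrow> nat) measure"
        let ?g = "\<lambda>x :: real \<Rightarrow> nat. map (\<lambda>t. int (x t)) ts"
        have "?g \<in> measurable ?P (count_space UNIV)"
          by (rule measurable_map_count_space)
            (rule measurable_compose[OF measurable_component_singleton], use ts in auto)
        then have "?g -` A \<inter> space ?P \<in> sets ?P"
          by (rule measurable_sets) simp
        then have "(\<lambda>\<omega>. \<lambda>t\<in>{0..}. N t \<omega>) -` (?g -` A \<inter> space ?P) \<inter> space M \<in> source_algebra M N J \<xi> Clock"
          unfolding source_algebra.simps by (rule in_vimage_algebra)
        also have "(\<lambda>\<omega>. \<lambda>t\<in>{0..}. N t \<omega>) -` (?g -` A \<inter> space ?P) \<inter> space M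
            = source_value ts Clock -` A \<inter> space M"
        proof -
          have g: "?g (\<lambda>t\<in>{0..}. N t \<omega>) = source_value ts Clock \<omega>" for \<omega>
            using ts by (auto simp: fun_eq_iff)
          have sp: "(\<lambda>t\<in>{0..}. N t \<omega>) \<in> space ?P" for \<omega>
            by (simp add: space_PiM)
          show ?thesis
            by (rule set_eqI) (simp only: vimage_eq Int_iff g sp simp_thms)
        qed
        finally show ?thesis using Clock by simp
      qed
    qed
  qed
qed

text \<open>Fubini for the clock against all other sources: the event counts are read off at
  \<omega>, while the initial direction and the turns are averaged over an independent \<omega>'. In
  the inner integral the counts are then constants.\<close>

lemma expectation_given_clock:
  fixes \<Phi> :: "bool list \<Rightarrow> complex"
  assumes ts: "\<And>t. t \<in> set ts \<Longrightarrow> 0 \<le> t" and bound: "\<And>l. norm (\<Phi> l) \<le> B"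
  shows "(LINT \<omega>|M. \<Phi> (map (\<lambda>t. vertical (N t \<omega>) \<omega>) ts)) =
    (LINT \<omega>|M. LINT \<omega>'|M. \<Phi> (map (\<lambda>t. vertical (N t \<omega>) \<omega>') ts))"
proof -
  define D where "D = - {Clock}"
  let ?C = "\<lambda>_::noise_source. count_space (UNIV :: int list set)"
  have ind: "indep_var (PiM {Clock} ?C) (\<lambda>\<omega>. \<lambda>s\<in>{Clock}. source_value ts s \<omega>)
      (PiM D ?C) (\<lambda>\<omega>. \<lambda>s\<in>D. source_value ts s \<omega>)"
    by (rule indep_var_restrict[OF indep_source_value[OF ts]]) (auto simp: D_def)
  \<comment> \<open>Rebuilds \<open>vertical\<close> from source values. The clock sample stores the
    counts as integers, which \<open>nat\<close> undoes.\<close>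
  define v where "v y m \<longleftrightarrow> odd (hd (y Initial) + (\<Sum>k<nat m. hd (y (Turn k))))"
    for y :: "noise_source \<Rightarrow> int list" and m
  define f where "f x y = \<Phi> (map (v y) (x Clock))" for x y :: "noise_source \<Rightarrow> int list"
  have hd: "(\<lambda>y. hd (y s)) \<in> measurable (PiM D ?C) (count_space UNIV)" if "s \<noteq> Clock" for s
    by (rule measurable_compose[OF measurable_component_singleton]) (use that in \<open>auto simp: D_def\<close>)
  have v: "(\<lambda>y. v y m) \<in> measurable (PiM D ?C) (count_space UNIV)" for m
  proof -
    have "(\<lambda>y. hd (y Initial) + (\<Sum>k<nat m. hd (y (Turn k)))) \<in> measurable (PiM D ?C) (count_space UNIV)"
      by (rule measurable_compose_countable[OF _ hd[of Initial],
            where f = "\<lambda>j y. j + (\<Sum>k<nat m. hd (y (Turn k)))"])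
        (rule measurable_compose[OF measurable_sum_count_space[OF hd]], simp_all)
    then show ?thesis
      unfolding v_def by (rule measurable_compose) simp
  qed
  \<comment> \<open>The clock sample takes countably many values, so joint measurability reduces to
    a fixed list \<open>l\<close> of counts.\<close>
  have l: "(\<lambda>z. \<Phi> (map (v (snd z)) l)) \<in> borel_measurable (PiM {Clock} ?C \<Otimes>\<^sub>M PiM D ?C)" for l
    by (rule measurable_compose[OF measurable_snd])
      (rule measurable_compose[OF measurable_map_count_space[OF v]], simp)
  have meas: "case_prod f \<in> borel_measurable (PiM {Clock} ?C \<Otimes>\<^sub>M PiM D ?C)"
    unfolding f_def split_beta'
    by (rule measurable_compose_countable[OF l])
      (rule measurable_compose[OF measurable_fst measurable_component_singleton], simp)
  have v_eq: "v (\<lambda>s\<in>D. source_value ts s \<omega>) (int m) = vertical m \<omega>" for m \<omega>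
    by (simp add: v_def D_def vertical_def)
  have "f (\<lambda>s\<in>{Clock}. source_value ts s \<omega>) (\<lambda>s\<in>D. source_value ts s \<omega>') =
      \<Phi> (map (\<lambda>t. vertical (N t \<omega>) \<omega>') ts)" for \<omega> \<omega>'
    by (simp add: f_def comp_def v_eq)
  then show ?thesis
    using indep_var_integral_iterated[OF ind meas, of B] bound by (simp add: f_def)
qed

text \<open>The values of \<open>\<xi> k\<close> are prescribed only up to a null set. The events
  for 1 and -1 therefore bound the probability from below, and the event for the even value 2 bounds
  it from above.\<close>

lemma prob_odd_turn: "prob {\<omega> \<in> space M. odd (\<xi> k \<omega>)} = p + q"
proof -
  have m: "{\<omega> \<in> space M. P (\<xi> k \<omega>)} \<in> events" for P
  proof -
    have "\<xi> k -` {j. P j} \<inter> space M \<in> events"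
      by (rule measurable_sets[OF measurable_turn]) simp
    then show ?thesis by (simp add: vimage_def Int_def conj_commute)
  qed
  have "p + q = prob ({\<omega> \<in> space M. \<xi> k \<omega> = 1} \<union> {\<omega> \<in> space M. \<xi> k \<omega> = -1})"
    using turn_counterclockwise[of k] turn_clockwise[of k]
    by (subst finite_measure_Union) (auto intro: m)
  also have "\<dots> \<le> prob {\<omega> \<in> space M. odd (\<xi> k \<omega>)}"
    by (rule finite_measure_mono) (auto intro: m)
  finally have lower: "p + q \<le> prob {\<omega> \<in> space M. odd (\<xi> k \<omega>)}" .
  have "1 - p - q \<le> prob {\<omega> \<in> space M. \<not> odd (\<xi> k \<omega>)}"
    unfolding turn_reflection[of k, symmetric]
    by (rule finite_measure_mono) (auto intro: m)
  also have "\<dots> = 1 - prob {\<omega> \<in> space M. odd (\<xi> k \<omega>)}"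
    by (rule prob_neg) (rule m)
  finally show ?thesis using lower by simp
qed

lemma prob_odd_initial: "prob {\<omega> \<in> space M. odd (J \<omega>)} = 1 / 2"
proof -
  have "prob {\<omega> \<in> space M. odd (J \<omega>)} = measure (distr M (count_space UNIV) J) {j. odd j}"
    by (subst measure_distr[OF measurable_J]) (auto intro: arg_cong[where f = prob])
  also have "\<dots> = measure (measure_pmf (pmf_of_set {0, 1, 2, 3 :: int})) {j. odd j}"
    by (simp add: J_uniform)
  also have "\<dots> = card ({0, 1, 2, 3 :: int} \<inter> {j. odd j}) / card {0, 1, 2, 3 :: int}"
    by (rule measure_pmf_of_set) auto
  also have "{0, 1, 2, 3 :: int} \<inter> {j. odd j} = {1, 3}" by auto
  finally show ?thesis by simp
qed

lemma expectation_flip_turn: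
  "(LINT \<omega>|M. complex_of_real (flip_sign (odd (\<xi> k \<omega>)))) = complex_of_real (1 - 2 * (p + q))"
proof -
  have "Measurable.pred M (\<lambda>\<omega>. odd (\<xi> k \<omega>))"
    by (rule measurable_compose[OF measurable_turn]) simp
  from expectation_flip_sign[OF this] show ?thesis
    by (simp add: prob_odd_turn)
qed

lemma expectation_flip_initial:
  "(LINT \<omega>|M. complex_of_real (flip_sign (odd (J \<omega>)))) = 0"
proof -
  have "Measurable.pred M (\<lambda>\<omega>. odd (J \<omega>))"
    by (rule measurable_compose[OF measurable_J]) simp
  from expectation_flip_sign[OF this] show ?thesis
    by (simp add: prob_odd_initial)
qed

text \<open>Parities add, so signs multiply.\<close>

lemma flip_sign_vertical_add:
  assumes "m \<le> m'"
  shows "flip_sign (vertical m' \<omega>) = flip_sign (vertical m \<omega>) * (\<Prod>k\<in>{m..<m'}. flip_sign (odd (\<xi> k \<omega>)))"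
  using assms
proof (induction m' rule: dec_induct)
  case (step n)
  have "vertical (Suc n) \<omega> \<longleftrightarrow> vertical n \<omega> \<noteq> odd (\<xi> n \<omega>)"
    by (auto simp: vertical_def)
  then have "flip_sign (vertical (Suc n) \<omega>) = flip_sign (vertical n \<omega>) * flip_sign (odd (\<xi> n \<omega>))"
    by (simp add: flip_sign_def)
  then show ?case using step by (simp add: prod.atLeastLessThan_Suc)
qed simp

text \<open>The turns numbered \<open>m\<close> to \<open>m' - 1\<close> are independent of one
  another and of all that decides the signs up to \<open>m\<close>, and each has mean sign
  \<open>1 - 2 * (p + q)\<close>.\<close>

lemma expectation_vertical_step:
  fixes \<Phi> :: "bool list \<Rightarrow> complex"
  assumes ms: "\<And>n. n \<in> set ms \<Longrightarrow> n \<le> m" and "m \<le> m'" and bound: "\<And>l. norm (\<Phi> l) \<le> B"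
  shows "(LINT \<omega>|M. \<Phi> (map (\<lambda>n. vertical n \<omega>) ms) * complex_of_real (flip_sign (vertical m' \<omega>))) =
    complex_of_real ((1 - 2 * (p + q)) ^ (m' - m)) *
    (LINT \<omega>|M. \<Phi> (map (\<lambda>n. vertical n \<omega>) ms) * complex_of_real (flip_sign (vertical m \<omega>)))"
proof -
  let ?C = "\<lambda>_::noise_source. count_space (UNIV :: int list set)"
  \<comment> \<open>\<open>A\<close> collects the sources of the past up to event \<open>m\<close>,
    \<open>D\<close> the turns after it. The clock is in neither, hence the empty list of sample
    times.\<close>
  define A where "A = insert Initial (Turn ` {..<m})"
  define D where "D = Turn ` {m..<m'}"
  let ?X = "\<lambda>\<omega>. \<lambda>s\<in>A. source_value [] s \<omega>" and ?Y = "\<lambda>\<omega>. \<lambda>s\<in>D. source_value [] s \<omega>"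
  have indV: "indep_vars ?C (source_value []) UNIV"
    by (rule indep_source_value) simp
  have ind: "indep_var (PiM A ?C) ?X (PiM D ?C) ?Y"
    by (rule indep_var_restrict[OF indV]) (auto simp: A_def D_def)
  define v where "v n y \<longleftrightarrow> odd (hd (y Initial) + (\<Sum>k<n. hd (y (Turn k))))"
    for y :: "noise_source \<Rightarrow> int list" and n
  define f where "f y = \<Phi> (map (\<lambda>n. v n y) ms) * complex_of_real (flip_sign (v m y))"
    for y :: "noise_source \<Rightarrow> int list"
  define e where "e l = complex_of_real (flip_sign (odd (hd l)))" for l :: "int list"
  define g where "g y = (\<Prod>s\<in>D. e (y s))" for y :: "noise_source \<Rightarrow> int list"
  have v_eq: "v n (?X \<omega>) = vertical n \<omega>" if "n \<le> m" for n \<omega>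
    using that by (simp add: v_def A_def vertical_def image_iff)
  have hd: "(\<lambda>y. hd (y s)) \<in> measurable (PiM A ?C) (count_space UNIV)" if "s \<in> A" for s
    by (rule measurable_compose[OF measurable_component_singleton[OF that]]) simp
  have v: "(\<lambda>y. v n y) \<in> measurable (PiM A ?C) (count_space UNIV)" if "n \<le> m" for n
  proof -
    have "(\<lambda>y. hd (y Initial) + (\<Sum>k<n. hd (y (Turn k)))) \<in> measurable (PiM A ?C) (count_space UNIV)"
      by (rule measurable_compose_countable[OF _ hd[of Initial],
            where f = "\<lambda>j y. j + (\<Sum>k<n. hd (y (Turn k)))"])
        (rule measurable_compose[OF measurable_sum_count_space[OF hd]],
          use that in \<open>auto simp: A_def\<close>)
    then show ?thesis
      unfolding v_def by (rule measurable_compose) simp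
  qed
  have "(\<lambda>y. \<Phi> (map (\<lambda>n. v n y) ms)) \<in> borel_measurable (PiM A ?C)"
    by (rule measurable_compose[OF measurable_map_count_space]) (use ms in \<open>auto intro: v\<close>)
  moreover have "(\<lambda>y. complex_of_real (flip_sign (v m y))) \<in> borel_measurable (PiM A ?C)"
    by (rule measurable_compose[OF v]) auto
  ultimately have f: "f \<in> borel_measurable (PiM A ?C)"
    unfolding f_def[abs_def] by measurable
  have e: "e \<in> borel_measurable (count_space UNIV)" by simp
  have g: "g \<in> borel_measurable (PiM D ?C)"
    unfolding g_def[abs_def]
    by (intro borel_measurable_prod, rule measurable_compose[OF measurable_component_singleton]) (auto intro: e)
  have ind': "indep_var borel (f \<circ> ?X) borel (g \<circ> ?Y)"
    by (rule indep_var_compose[OF ind f g])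
  have norm_e: "norm (e l) = 1" for l by (simp add: e_def)
  have int1: "integrable M (f \<circ> ?X)"
    by (rule integrable_const_bound[of _ B])
      (use bound indep_var_rv1[OF ind'] in \<open>auto simp: f_def norm_mult\<close>)
  have int2: "integrable M (g \<circ> ?Y)"
    by (rule integrable_const_bound[of _ 1])
      (use indep_var_rv2[OF ind'] in \<open>auto simp: g_def norm_e simp flip: prod_norm\<close>)
  have eX: "(LINT \<omega>|M. e (source_value [] (Turn k) \<omega>)) = complex_of_real (1 - 2 * (p + q))" for k
    using expectation_flip_turn[of k] by (simp add: e_def)
  have "(LINT \<omega>|M. (g \<circ> ?Y) \<omega>) = (LINT \<omega>|M. (\<Prod>s\<in>D. e (source_value [] s \<omega>)))"
    by (simp add: g_def)
  also have "\<dots> = (\<Prod>s\<in>D. LINT \<omega>|M. e (source_value [] s \<omega>))"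
  proof (rule indep_vars_lebesgue_integral)
    show "indep_vars (\<lambda>_. borel) (\<lambda>s \<omega>. e (source_value [] s \<omega>)) D"
      by (rule indep_vars_compose2[OF indep_vars_subset[OF indV]]) auto
    show "integrable M (\<lambda>\<omega>. e (source_value [] s \<omega>))" if "s \<in> D" for s
    proof (rule integrable_const_bound[of _ 1])
      show "(\<lambda>\<omega>. e (source_value [] s \<omega>)) \<in> borel_measurable M"
        by (rule measurable_compose[OF _ e])
          (use indV in \<open>auto simp: indep_vars_def2\<close>)
    qed (simp add: norm_e)
  qed (simp add: D_def)
  also have "\<dots> = complex_of_real ((1 - 2 * (p + q)) ^ (m' - m))"
    unfolding D_def by (subst prod.reindex) (auto simp: inj_on_def eX simp del: source_value.simps)
  finally have Eg: "(LINT \<omega>|M. (g \<circ> ?Y) \<omega>) = complex_of_real ((1 - 2 * (p + q)) ^ (m' - m))" .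
  have fX: "(f \<circ> ?X) \<omega> = \<Phi> (map (\<lambda>n. vertical n \<omega>) ms) * complex_of_real (flip_sign (vertical m \<omega>))" for \<omega>
    using ms by (simp add: f_def v_eq cong: map_cong)
  have gY: "(g \<circ> ?Y) \<omega> = (\<Prod>k\<in>{m..<m'}. complex_of_real (flip_sign (odd (\<xi> k \<omega>))))" for \<omega>
    unfolding g_def D_def comp_def by (subst prod.reindex) (auto simp: inj_on_def e_def)
  have "\<Phi> (map (\<lambda>n. vertical n \<omega>) ms) * complex_of_real (flip_sign (vertical m' \<omega>)) =
      (f \<circ> ?X) \<omega> * (g \<circ> ?Y) \<omega>" for \<omega>
    unfolding fX gY flip_sign_vertical_add[OF \<open>m \<le> m'\<close>] by simp
  then have "(LINT \<omega>|M. \<Phi> (map (\<lambda>n. vertical n \<omega>) ms) * complex_of_real (flip_sign (vertical m' \<omega>)))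
      = (LINT \<omega>|M. (f \<circ> ?X) \<omega> * (g \<circ> ?Y) \<omega>)" by simp
  also have "\<dots> = (LINT \<omega>|M. (f \<circ> ?X) \<omega>) * (LINT \<omega>|M. (g \<circ> ?Y) \<omega>)"
    by (rule indep_var_lebesgue_integral[OF ind' int1 int2])
  finally show ?thesis unfolding Eg fX by simp
qed

lemma expectation_power_increment:
  assumes "0 \<le> s" "s < t" "\<bar>z\<bar> \<le> 1"
  shows "(LINT \<omega>|M. z ^ (N t \<omega> - N s \<omega>)) = exp (- rate * (t - s) * (1 - z))"
proof -
  have m: "(\<lambda>\<omega>. N t \<omega> - N s \<omega>) \<in> measurable M (count_space UNIV)"
    by (rule measurable_compose_countable[OF _ measurable_N, where f = "\<lambda>a \<omega>. a - N s \<omega>"])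
      (rule measurable_compose[OF measurable_N], use assms in auto)
  have "(LINT \<omega>|M. z ^ (N t \<omega> - N s \<omega>)) =
      (LINT n|distr M (count_space UNIV) (\<lambda>\<omega>. N t \<omega> - N s \<omega>). z ^ n)"
    by (rule integral_distr[symmetric, OF m]) simp
  also have "\<dots> = exp (- rate * (t - s) * (1 - z))"
    using N_poisson_increments[of s t] poisson_pgf[of "rate * (t - s)" z] assms rate_pos by simp
  finally show ?thesis .
qed

text \<open>Given the clock, the last cell contributes \<open>\<rho> ^ d k\<close> with
  \<open>\<rho> = 1 - 2 * (p + q)\<close>. The increment \<open>d k\<close> is Poisson and
  independent of the earlier counts, and its generating function at \<open>\<rho>\<close> is the
  exponential factor. The arbitrary bounded \<open>\<Phi>\<close> of the history expresses
  conditioning on that history.\<close>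

lemma vertical_markov:
  fixes \<Phi> :: "bool list \<Rightarrow> complex" and h :: real and k :: nat
  assumes h: "0 < h" and bound: "\<And>l. norm (\<Phi> l) \<le> B"
  defines "hist \<equiv> (\<lambda>\<omega>. map (\<lambda>i. vertical (N (real i * h) \<omega>) \<omega>) [0..<Suc k])"
  shows "(LINT \<omega>|M. \<Phi> (hist \<omega>) * complex_of_real (flip_sign (vertical (N (real (Suc k) * h) \<omega>) \<omega>))) =
    exp (- 2 * (rate * (p + q)) * h) *
    (LINT \<omega>|M. \<Phi> (hist \<omega>) * complex_of_real (flip_sign (vertical (N (real k * h) \<omega>) \<omega>)))"
proof -
  let ?s = "\<lambda>b. complex_of_real (flip_sign b)"
  define \<rho> where "\<rho> = 1 - 2 * (p + q)"
  have \<rho>: "\<bar>\<rho>\<bar> \<le> 1" using turn_probs by (simp add: \<rho>_def)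
  have B: "0 \<le> B" using norm_ge_zero bound by (rule order_trans)
  define d where "d i \<omega> = N (real (Suc i) * h) \<omega> - N (real i * h) \<omega>" for i \<omega>
  define counts where "counts \<omega> = map (\<lambda>i. N (real i * h) \<omega>) [0..<Suc k]" for \<omega>
  \<comment> \<open>The mean over directions for frozen counts; it sees the clock only through the
    counts up to time \<open>real k * h\<close>.\<close>
  define G where "G l = (LINT \<omega>'|M. \<Phi> (map (\<lambda>n. vertical n \<omega>') l) * ?s (vertical (last l) \<omega>'))" for l
  have grid_nonneg: "0 \<le> x" if "x \<in> set (map (\<lambda>i. real i * h) [0..<n])" for x n
    using that h by auto
  have N_le: "N (real i * h) \<omega> \<le> N (real j * h) \<omega>" if "\<omega> \<in> space M" "i \<le> j" for i j \<omega>
    by (rule mono_onD[OF N_mono]) (use that h in \<open>auto intro: mult_right_mono\<close>)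
  have N_eq: "N (real i * h) \<omega> = (\<Sum>j<i. d j \<omega>)" if "\<omega> \<in> space M" for i \<omega>
  proof (induction i)
    case (Suc i)
    have "N (real (Suc i) * h) \<omega> = N (real i * h) \<omega> + d i \<omega>"
      using N_le[OF that, of i "Suc i"] by (simp add: d_def)
    with Suc show ?case by simp
  qed (use N_zero[OF that] in simp)
  have lastc: "last (counts \<omega>) = N (real k * h) \<omega>" for \<omega>
    by (simp add: counts_def)

  have "(LINT \<omega>|M. \<Phi> (hist \<omega>) * ?s (vertical (N (real (Suc k) * h) \<omega>) \<omega>)) =
      (LINT \<omega>|M. LINT \<omega>'|M. \<Phi> (map (\<lambda>n. vertical n \<omega>') (counts \<omega>)) *
        ?s (vertical (N (real (Suc k) * h) \<omega>) \<omega>'))"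
  proof -
    \<comment> \<open>The list sampled at \<open>Suc (Suc k)\<close> times ends with the sign at the
      new time, so \<open>butlast\<close> is the history and \<open>last\<close> that sign.\<close>
    have "norm (\<Phi> (butlast l) * ?s (last l)) \<le> B" for l
      using bound by (simp add: norm_mult)
    from expectation_given_clock[where ts = "map (\<lambda>i. real i * h) [0..<Suc (Suc k)]"
        and \<Phi> = "\<lambda>l. \<Phi> (butlast l) * ?s (last l)", OF grid_nonneg[of _ "Suc (Suc k)"] this] show ?thesis
      by (simp add: hist_def counts_def comp_def butlast_append)
  qed
  also have "\<dots> = (LINT \<omega>|M. complex_of_real (\<rho> ^ d k \<omega>) * G (counts \<omega>))"
  proof (rule Bochner_Integration.integral_cong[OF refl])
    fix \<omega> assume \<omega>: "\<omega> \<in> space M"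
    show "(LINT \<omega>'|M. \<Phi> (map (\<lambda>n. vertical n \<omega>') (counts \<omega>)) *
        ?s (vertical (N (real (Suc k) * h) \<omega>) \<omega>')) = complex_of_real (\<rho> ^ d k \<omega>) * G (counts \<omega>)"
      unfolding G_def lastc d_def \<rho>_def
      by (rule expectation_vertical_step[OF _ _ bound])
        (use N_le[OF \<omega>] N_le[OF \<omega>, of k "Suc k"] in \<open>auto simp: counts_def\<close>)
  qed
  also have "\<dots> = (LINT \<omega>|M. complex_of_real (\<rho> ^ d k \<omega>)) * (LINT \<omega>|M. G (counts \<omega>))"
  proof -
    let ?C = "\<lambda>_::nat. count_space (UNIV :: nat set)"
    let ?X = "\<lambda>\<omega>. \<lambda>i\<in>{k}. d i \<omega>" and ?Y = "\<lambda>\<omega>. \<lambda>i\<in>{..<k}. d i \<omega>"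
    define f where "f x = complex_of_real (\<rho> ^ x k)" for x :: "nat \<Rightarrow> nat"
    \<comment> \<open>The path starts at 0, so the counts are partial sums of the increments, and
      \<open>G (counts \<omega>)\<close> depends only on the increments before cell
      \<open>k\<close>.\<close>
    define g where "g x = G (map (\<lambda>i. \<Sum>j<i. x j) [0..<Suc k])" for x :: "nat \<Rightarrow> nat"
    have "indep_vars ?C d {..<Suc k}"
      unfolding d_def using h
      by (intro N_indep_increments) (auto intro!: mono_onI mult_right_mono)
    then have ind: "indep_var (PiM {k} ?C) ?X (PiM {..<k} ?C) ?Y"
      by (rule indep_var_restrict) auto
    have f: "f \<in> borel_measurable (PiM {k} ?C)"
      unfolding f_def[abs_def]
      by (rule measurable_compose[OF measurable_component_singleton]) auto
    have "(\<lambda>x. map (\<lambda>i. \<Sum>j<i. x j) [0..<Suc k]) \<in> measurable (PiM {..<k} ?C) (count_space UNIV)"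
      by (intro measurable_map_count_space measurable_sum_count_space measurable_component_singleton) auto
    then have g: "g \<in> borel_measurable (PiM {..<k} ?C)"
      unfolding g_def[abs_def] by (rule measurable_compose) simp
    have ind': "indep_var borel (f \<circ> ?X) borel (g \<circ> ?Y)"
      by (rule indep_var_compose[OF ind f g])
    have normG: "norm (G l) \<le> B" for l
    proof -
      have "norm (G l) \<le> (LINT \<omega>'|M. norm (\<Phi> (map (\<lambda>n. vertical n \<omega>') l) * ?s (vertical (last l) \<omega>')))"
        unfolding G_def by (rule integral_norm_bound)
      also have "\<dots> \<le> (LINT \<omega>'|M. B)"
        by (rule integral_mono') (use bound B in \<open>auto simp: norm_mult\<close>)
      finally show ?thesis by (simp add: prob_space)
    qed
    have int1: "integrable M (f \<circ> ?X)"
      by (rule integrable_const_bound[of _ 1])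
        (use \<rho> indep_var_rv1[OF ind'] in \<open>auto simp: f_def norm_power power_le_one\<close>)
    have int2: "integrable M (g \<circ> ?Y)"
      by (rule integrable_const_bound[of _ B])
        (use indep_var_rv2[OF ind'] normG in \<open>auto simp: g_def\<close>)
    have X: "(f \<circ> ?X) \<omega> = complex_of_real (\<rho> ^ d k \<omega>)" for \<omega>
      by (simp add: f_def)
    have Y: "(g \<circ> ?Y) \<omega> = G (counts \<omega>)" if "\<omega> \<in> space M" for \<omega>
    proof -
      have "map (\<lambda>i. \<Sum>j<i. ?Y \<omega> j) [0..<Suc k] = counts \<omega>"
        unfolding counts_def N_eq[OF that] by (rule map_cong) auto
      then show ?thesis by (simp add: g_def)
    qed
    have "(LINT \<omega>|M. complex_of_real (\<rho> ^ d k \<omega>) * G (counts \<omega>)) = (LINT \<omega>|M. (f \<circ> ?X) \<omega> * (g \<circ> ?Y) \<omega>)"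
      by (rule Bochner_Integration.integral_cong) (simp_all only: X Y)
    also have "\<dots> = (LINT \<omega>|M. (f \<circ> ?X) \<omega>) * (LINT \<omega>|M. (g \<circ> ?Y) \<omega>)"
      by (rule indep_var_lebesgue_integral[OF ind' int1 int2])
    also have "(LINT \<omega>|M. (g \<circ> ?Y) \<omega>) = (LINT \<omega>|M. G (counts \<omega>))"
      by (rule Bochner_Integration.integral_cong) (simp_all only: Y)
    finally show ?thesis unfolding X .
  qed
  also have "(LINT \<omega>|M. complex_of_real (\<rho> ^ d k \<omega>)) = exp (- 2 * (rate * (p + q)) * h)"
    using expectation_power_increment[of "real k * h" "real (Suc k) * h" \<rho>] h \<rho>
    by (simp add: d_def \<rho>_def algebra_simps del: of_real_power flip: exp_of_real)
  \<comment> \<open>The freezing of the clock is undone. The history already ends with the sign at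
    time \<open>real k * h\<close>, so here \<open>\<Phi>\<close> receives the full list.\<close>
  also have "(LINT \<omega>|M. G (counts \<omega>)) =
      (LINT \<omega>|M. \<Phi> (hist \<omega>) * ?s (vertical (N (real k * h) \<omega>) \<omega>))"
  proof -
    have "norm (\<Phi> l * ?s (last l)) \<le> B" for l
      using bound by (simp add: norm_mult)
    from expectation_given_clock[where ts = "map (\<lambda>i. real i * h) [0..<Suc k]"
        and \<Phi> = "\<lambda>l. \<Phi> l * ?s (last l)", OF grid_nonneg[of _ "Suc k"] this] show ?thesis
      by (simp add: hist_def counts_def comp_def G_def)
  qed
  finally show ?thesis by simp
qed

end

section \<open>Riemann sums along a counting path\<close>

text \<open>Clamping at 0 makes the path monotone on the whole line, hence Borel. The floor recovers
  the natural number, so that an arbitrary \<open>f\<close> can be applied.\<close>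

lemma borel_measurable_counting_path:
  fixes c :: "real \<Rightarrow> nat" and f :: "nat \<Rightarrow> real"
  assumes "mono_on {0..} c"
  shows "(\<lambda>x. f (c (max 0 x))) \<in> borel_measurable borel"
proof -
  have "mono (\<lambda>x. real (c (max 0 x)))"
    by (intro monoI of_nat_mono mono_onD[OF assms]) auto
  then have "(\<lambda>x. real (c (max 0 x))) \<in> borel_measurable borel"
    by (rule borel_measurable_mono)
  then have "(\<lambda>x. \<lfloor>real (c (max 0 x))\<rfloor>) \<in> measurable borel (count_space UNIV)"
    by (rule measurable_compose[OF _ measurable_real_floor])
  then have "(\<lambda>x. f (nat \<lfloor>real (c (max 0 x))\<rfloor>)) \<in> borel_measurable borel"
    by (rule measurable_compose) simp
  then show ?thesis by simp
qed

text \<open>On a cell where the counter does not move the integrand is constant, so each cell contributes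
  an error of at most its length times the increment of the counter, and the increments telescope.\<close>

lemma counting_path_riemann_sum:
  fixes c :: "real \<Rightarrow> nat" and f :: "nat \<Rightarrow> real"
  assumes c: "mono_on {0..} c" and f: "\<And>n. 0 \<le> f n" "\<And>n. f n \<le> 1" and h: "0 \<le> h"
  shows "\<bar>(LBINT x:{0..real n * h}. f (c x)) - h * (\<Sum>k<n. f (c (real k * h)))\<bar>
    \<le> h * (real (c (real n * h)) - real (c 0))"
proof -
  have set_int: "set_integrable lborel {a..b} (\<lambda>x. f (c x))" if "0 \<le> a" for a b
  proof -
    have "set_integrable lborel {a..b} (\<lambda>x. f (c (max 0 x)))"
      unfolding set_integrable_def
    proof (rule Bochner_Integration.integrable_bound)
      show "integrable lborel (indicator {a..b} :: real \<Rightarrow> real)"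
        by (rule integrable_real_indicator) (auto simp: emeasure_lborel_Icc_eq)
      show "(\<lambda>x. indicator {a..b} x *\<^sub>R f (c (max 0 x))) \<in> borel_measurable lborel"
        using borel_measurable_counting_path[OF c, of f] by measurable
    qed (use f in \<open>auto simp: indicator_def\<close>)
    then show ?thesis
      by (rule set_integrable_cong[THEN iffD1, rotated -1]) (use that in auto)
  qed
  have int: "(\<lambda>x. f (c x)) integrable_on {a..b}" if "0 \<le> a" for a b
    using set_borel_integral_eq_integral(1)[OF set_int[OF that]] .
  have cell: "\<bar>integral {a..b} (\<lambda>x. f (c x)) - (b - a) * f (c a)\<bar> \<le> (b - a) * (real (c b) - real (c a))"
    if ab: "0 \<le> a" "a \<le> b" for a b
  proof -
    have "norm (integral {a..b} (\<lambda>x. f (c x) - f (c a))) \<le> integral {a..b} (\<lambda>x. real (c b) - real (c a))"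
    proof (rule integral_norm_bound_integral)
      show "norm (f (c x) - f (c a)) \<le> real (c b) - real (c a)" if "x \<in> {a..b}" for x
      proof -
        have "c a \<le> c x" "c x \<le> c b"
          using that ab by (auto intro!: mono_onD[OF c])
        \<comment> \<open>A counter that has moved has moved by at least 1, which covers any change
          of a function with values in the unit interval.\<close>
        moreover have "\<bar>f (c x) - f (c a)\<bar> \<le> 1"
          using f[of "c x"] f[of "c a"] by simp
        ultimately show ?thesis
          by (cases "c x = c a") auto
      qed
    qed (auto intro!: integrable_diff int ab)
    also have "integral {a..b} (\<lambda>x. f (c x) - f (c a)) = integral {a..b} (\<lambda>x. f (c x)) - (b - a) * f (c a)"
      using ab by (subst integral_diff) (auto intro!: int)
    finally show ?thesis using ab by simp
  qed
  have "\<bar>integral {0..real n * h} (\<lambda>x. f (c x)) - h * (\<Sum>k<n. f (c (real k * h)))\<bar>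
    \<le> h * (real (c (real n * h)) - real (c 0))"
  proof (induction n)
    case (Suc n)
    have "integral {0..real (Suc n) * h} (\<lambda>x. f (c x)) =
        integral {0..real n * h} (\<lambda>x. f (c x)) + integral {real n * h..real (Suc n) * h} (\<lambda>x. f (c x))"
      by (rule Henstock_Kurzweil_Integration.integral_combine[symmetric])
        (use h in \<open>auto intro!: mult_right_mono int\<close>)
    with Suc cell[of "real n * h" "real (Suc n) * h"] h show ?case
      by (simp add: algebra_simps)
  qed simp
  then show ?thesis
    by (simp add: set_borel_integral_eq_integral(2)[OF set_int])
qed

section \<open>The telegraph recursion\<close>

text \<open>With h = t/n, one step multiplies \<open>z\<close> by \<open>exp (\<kappa> * h)\<close>
  up to an error o(h), so n steps accumulate an error n o(t/n), which vanishes.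
  \<open>Re \<kappa> \<le> 0\<close> keeps earlier errors from being amplified.\<close>

lemma telegraph_recursion_limit:
  fixes u w :: "nat \<Rightarrow> nat \<Rightarrow> complex" and \<kappa> \<beta> \<mu> :: complex and t :: real
  assumes t: "0 < t"
    and u_Suc: "\<And>n k. 0 < n \<Longrightarrow> u n (Suc k) =
      cos (\<beta> * of_real (t / real n)) * u n k + \<i> * sin (\<beta> * of_real (t / real n)) * w n k"
    and w_Suc: "\<And>n k. 0 < n \<Longrightarrow> w n (Suc k) = exp (- 2 * \<mu> * of_real (t / real n)) *
      (cos (\<beta> * of_real (t / real n)) * w n k + \<i> * sin (\<beta> * of_real (t / real n)) * u n k)"
    and init: "\<And>n. u n 0 = 1" "\<And>n. w n 0 = 0"
    and bound: "\<And>n k. norm (u n k) \<le> 1" "\<And>n k. norm (w n k) \<le> 1"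
    and \<kappa>: "\<kappa>\<^sup>2 + 2 * \<mu> * \<kappa> + \<beta>\<^sup>2 = 0" and Re_\<kappa>: "Re \<kappa> \<le> 0"
  shows "(\<lambda>n. \<i> * \<beta> * u n n + \<kappa> * w n n) \<longlonglongrightarrow> \<i> * \<beta> * exp (\<kappa> * of_real t)"
proof -
  define z where "z n k = \<i> * \<beta> * u n k + \<kappa> * w n k" for n k
  \<comment> \<open>\<open>g1\<close> and \<open>g2\<close> are the coefficients of
    \<open>u n k\<close> and \<open>w n k\<close> in the one-step defect
    \<open>z n (Suc k) - exp (\<kappa> * h) * z n k\<close>, as functions of the step
    length.\<close>
  define g1 where "g1 x = \<i> * \<beta> * cos (\<beta> * x) + \<i> * \<kappa> * sin (\<beta> * x) * exp (- 2 * \<mu> * x) - \<i> * \<beta> * exp (\<kappa> * x)" for x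
  define g2 where "g2 x = \<kappa> * cos (\<beta> * x) * exp (- 2 * \<mu> * x) - \<beta> * sin (\<beta> * x) - \<kappa> * exp (\<kappa> * x)" for x
  have d1: "(g1 has_field_derivative 0) (at 0)"
    unfolding g1_def[abs_def] by (auto intro!: derivative_eq_intros)
  have d2: "(g2 has_field_derivative 0) (at 0)"
  proof -
    \<comment> \<open>The characteristic equation is exactly the vanishing of the first-order term
      of \<open>g2\<close>; in \<open>g1\<close> the first-order terms cancel for every
      \<kappa>.\<close>
    have "- (2 * \<mu> * \<kappa>) - \<beta> * \<beta> = \<kappa> * \<kappa>"
      using \<kappa> by algebra
    then show ?thesis
      unfolding g2_def[abs_def] by (auto intro!: derivative_eq_intros)
  qed
  \<comment> \<open>A function with value and derivative 0 at 0 is o(h), and n = t/h.\<close>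
  have vanish: "(\<lambda>n. real n * norm (g (of_real (t / real n)))) \<longlonglongrightarrow> 0"
    if d: "(g has_field_derivative 0) (at 0)" and g0: "g 0 = 0" for g :: "complex \<Rightarrow> complex"
  proof -
    have "(\<lambda>n. complex_of_real (t / real n)) \<longlonglongrightarrow> of_real 0"
      by (intro tendsto_of_real lim_const_over_n)
    then have F: "filterlim (\<lambda>n. complex_of_real (t / real n)) (at 0) sequentially"
      using t by (auto simp: filterlim_at intro!: eventually_sequentiallyI[of 1])
    have "((\<lambda>y. g y / y) \<longlongrightarrow> 0) (at 0)"
      using d g0 by (simp add: has_field_derivative_iff)
    from filterlim_compose[OF this F]
    have "(\<lambda>n. t * norm (g (of_real (t / real n)) / of_real (t / real n))) \<longlonglongrightarrow> t * norm (0::complex)"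
      by (intro tendsto_intros)
    \<comment> \<open>At \<open>n = 0\<close> the quotient \<open>t / real n\<close> is 0 and both
      sides are 0.\<close>
    moreover have "t * norm (g (of_real (t / real n)) / of_real (t / real n)) =
        real n * norm (g (of_real (t / real n)))" for n
      using t g0 by (cases "n = 0") (auto simp: norm_divide norm_mult field_simps)
    ultimately show ?thesis by simp
  qed
  define \<epsilon> where "\<epsilon> n = norm (g1 (of_real (t / real n))) + norm (g2 (of_real (t / real n)))" for n
  have \<epsilon>0: "(\<lambda>n. real n * \<epsilon> n) \<longlonglongrightarrow> 0"
    using tendsto_add[OF vanish[OF d1] vanish[OF d2]]
    by (simp add: \<epsilon>_def algebra_simps g1_def g2_def)
  have step: "norm (z n (Suc k) - exp (\<kappa> * of_real (t / real n)) * z n k) \<le> \<epsilon> n" if "0 < n" for n k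
  proof -
    have "z n (Suc k) - exp (\<kappa> * of_real (t / real n)) * z n k =
        g1 (of_real (t / real n)) * u n k + g2 (of_real (t / real n)) * w n k"
      unfolding z_def u_Suc[OF that] w_Suc[OF that] g1_def g2_def by (simp add: algebra_simps)
    also have "norm \<dots> \<le> norm (g1 (of_real (t / real n))) * 1 + norm (g2 (of_real (t / real n))) * 1"
      unfolding norm_mult[symmetric]
      by (rule norm_triangle_le) (intro add_mono, auto simp: norm_mult intro!: mult_left_le bound)
    finally show ?thesis by (simp add: \<epsilon>_def)
  qed
  have err: "norm (z n k - exp (\<kappa> * of_real (t / real n)) ^ k * z n 0) \<le> real k * \<epsilon> n" if "0 < n" for n k
  proof (induction k)
    case (Suc k)
    let ?e = "exp (\<kappa> * of_real (t / real n))"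
    have e: "norm ?e \<le> 1"
      using t Re_\<kappa> by (simp add: mult_nonpos_nonneg divide_nonpos_nonneg)
    have "z n (Suc k) - ?e ^ Suc k * z n 0 = (z n (Suc k) - ?e * z n k) + ?e * (z n k - ?e ^ k * z n 0)"
      by (simp add: algebra_simps)
    also have "norm \<dots> \<le> \<epsilon> n + 1 * (real k * \<epsilon> n)"
      by (rule norm_triangle_le) (unfold norm_mult, intro add_mono step[OF that] mult_mono e Suc, auto)
    finally show ?case by (simp add: algebra_simps)
  qed simp
  have "(\<lambda>n. z n n - \<i> * \<beta> * exp (\<kappa> * of_real t)) \<longlonglongrightarrow> 0"
  proof (rule Lim_null_comparison[OF _ \<epsilon>0])
    show "\<forall>\<^sub>F n in sequentially. norm (z n n - \<i> * \<beta> * exp (\<kappa> * of_real t)) \<le> real n * \<epsilon> n"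
    proof (rule eventually_sequentiallyI[of 1])
      fix n :: nat assume n: "1 \<le> n"
      have "exp (\<kappa> * of_real (t / real n)) ^ n = exp (\<kappa> * of_real t)"
        using n by (simp flip: exp_of_nat_mult)
      with err[of n n] n show "norm (z n n - \<i> * \<beta> * exp (\<kappa> * of_real t)) \<le> real n * \<epsilon> n"
        by (simp add: z_def init algebra_simps)
    qed
  qed
  then show ?thesis
    unfolding z_def by (simp add: LIM_zero_iff)
qed

section \<open>The characteristic function\<close>

text \<open>At an odd multiple of \<pi>/2 the cosine is 0 and the sine is 1 or -1, which gives the
  two vertical unit vectors. At an even multiple the sine is 0, so a vanishing cosine would
  contradict that the squares sum to 1.\<close>

lemma dir_vertical_iff: "dir j \<in> {dir 1, dir 3} \<longleftrightarrow> odd j"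
proof
  assume "odd j"
  then obtain k where k: "j = 2 * k + 1" by (elim oddE)
  have "pi * of_int j / 2 = of_int k * pi + pi / 2" by (simp add: k field_simps)
  then have "cos (pi * of_int j / 2) = - sin (of_int k * pi)" "sin (pi * of_int j / 2) = cos (of_int k * pi)"
    by (simp_all only: cos_add sin_add) simp_all
  moreover have "sin (of_int k * pi) = 0"
    by (simp add: sin_zero_iff_int2)
  moreover have "cos (of_int k * pi) = 1 \<or> cos (of_int k * pi) = - 1"
    using sin_cos_squared_add[of "of_int k * pi"] \<open>sin (of_int k * pi) = 0\<close>
    by (simp add: power2_eq_1_iff)
  moreover have "pi * 3 / 2 = pi + pi / 2" by simp
  then have "cos (pi * 3 / 2) = 0" "sin (pi * 3 / 2) = - 1"
    by (simp_all only: cos_add sin_add) simp_all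
  ultimately show "dir j \<in> {dir 1, dir 3}"
    by (auto simp: dir_def)
next
  assume *: "dir j \<in> {dir 1, dir 3}"
  show "odd j"
  proof
    assume "even j"
    then obtain k where k: "j = 2 * k" by (elim evenE)
    have "pi * 3 / 2 = pi + pi / 2" by simp
    then have "cos (pi * 3 / 2) = 0"
      by (simp only: cos_add sin_add) simp
    with * have "cos (of_int k * pi) = 0"
      by (auto simp: dir_def k mult.commute)
    moreover have "sin (of_int k * pi) = 0"
      by (simp add: sin_zero_iff_int2)
    ultimately show False
      using sin_cos_squared_add[of "of_int k * pi"] by simp
  qed
qed

context direction_process
begin

section \<open>Vertical time as a limit of Riemann sums\<close>

lemma measurable_vertical_at:
  assumes "0 \<le> s"
  shows "(\<lambda>\<omega>. vertical (N s \<omega>) \<omega>) \<in> measurable M (count_space UNIV)"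
  by (rule measurable_compose_countable[OF measurable_vertical measurable_N[OF assms]])

lemma vertical_time_eq:
  "vertical_time N J \<xi> s \<omega> = (LBINT x:{0..s}. of_bool (vertical (N x \<omega>) \<omega>))"
proof -
  have "indicator {dir 1, dir 3} (direction N J \<xi> x \<omega>) = (of_bool (vertical (N x \<omega>) \<omega>) :: real)" for x
    using dir_vertical_iff[of "J \<omega> + (\<Sum>k<N x \<omega>. \<xi> k \<omega>)"]
    by (simp only: direction_def vertical_def indicator_def of_bool_def)
  then show ?thesis by (simp add: vertical_time_def)
qed

definition sampled_vertical_time :: "real \<Rightarrow> nat \<Rightarrow> 'a \<Rightarrow> real" where
  "sampled_vertical_time s n \<omega> = s / real n * (\<Sum>k<n. of_bool (vertical (N (real k * (s / real n)) \<omega>) \<omega>))"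

text \<open>Each path has only \<open>N s \<omega>\<close> events up to \<open>s\<close>, so the
  Riemann error is at most that number times the mesh.\<close>

lemma sampled_vertical_time_tendsto:
  assumes "0 < s" and \<omega>: "\<omega> \<in> space M"
  shows "(\<lambda>n. sampled_vertical_time s n \<omega>) \<longlonglongrightarrow> vertical_time N J \<xi> s \<omega>"
proof -
  have "(\<lambda>n. sampled_vertical_time s n \<omega> - vertical_time N J \<xi> s \<omega>) \<longlonglongrightarrow> 0"
  proof (rule Lim_null_comparison)
    show "(\<lambda>n. s / real n * real (N s \<omega>)) \<longlonglongrightarrow> 0"
      by (intro tendsto_mult_left_zero lim_const_over_n)
    show "\<forall>\<^sub>F n in sequentially.
        norm (sampled_vertical_time s n \<omega> - vertical_time N J \<xi> s \<omega>) \<le> s / real n * real (N s \<omega>)"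
    proof (rule eventually_sequentiallyI[of 1])
      fix n :: nat assume "1 \<le> n"
      then have n: "real n * (s / real n) = s" by simp
      show "norm (sampled_vertical_time s n \<omega> - vertical_time N J \<xi> s \<omega>) \<le> s / real n * real (N s \<omega>)"
        using counting_path_riemann_sum[OF N_mono[OF \<omega>], of "\<lambda>m. of_bool (vertical m \<omega>)" "s / real n" n] assms
        by (simp only: n vertical_time_eq sampled_vertical_time_def N_zero[OF \<omega>])
          (simp add: abs_minus_commute)
    qed
  qed
  then show ?thesis by (rule LIM_zero_cancel)
qed

section \<open>Recursion for the means of the phase factors\<close>

definition phase :: "real \<Rightarrow> real \<Rightarrow> nat \<Rightarrow> 'a \<Rightarrow> complex" where
  "phase b h k \<omega> = (\<Prod>i<k. cis (b * h * flip_sign (vertical (N (real i * h) \<omega>) \<omega>)))"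

lemma norm_phase [simp]: "norm (phase b h k \<omega>) = 1"
  by (simp add: phase_def flip: prod_norm)

lemma measurable_phase:
  assumes "0 \<le> h"
  shows "phase b h k \<in> borel_measurable M"
  unfolding phase_def[abs_def]
proof (intro borel_measurable_prod)
  fix i
  show "(\<lambda>\<omega>. cis (b * h * flip_sign (vertical (N (real i * h) \<omega>) \<omega>))) \<in> borel_measurable M"
    by (rule measurable_compose[OF measurable_vertical_at]) (use assms in auto)
qed

definition phase_mean :: "real \<Rightarrow> real \<Rightarrow> nat \<Rightarrow> complex" where
  "phase_mean b h k = (LINT \<omega>|M. phase b h k \<omega>)"

text \<open>In the notation of the overview \<open>phase\<close> is \<open>Z\<^sub>k\<close>,
  \<open>phase_mean\<close> is \<open>u\<^sub>k\<close>, and this is \<open>w\<^sub>k\<close>. The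
  sign is taken at \<open>real k * h\<close>, one cell past the last factor of the phase, and is the
  one that enters the next factor.\<close>

definition signed_phase_mean :: "real \<Rightarrow> real \<Rightarrow> nat \<Rightarrow> complex" where
  "signed_phase_mean b h k =
    (LINT \<omega>|M. phase b h k \<omega> * complex_of_real (flip_sign (vertical (N (real k * h) \<omega>) \<omega>)))"

lemma integrable_phase:
  assumes "0 \<le> h"
  shows "integrable M (phase b h k)"
    and "integrable M (\<lambda>\<omega>. phase b h k \<omega> * complex_of_real (flip_sign (vertical (N (real k * h) \<omega>) \<omega>)))"
proof -
  have "(\<lambda>\<omega>. complex_of_real (flip_sign (vertical (N (real k * h) \<omega>) \<omega>))) \<in> borel_measurable M"
    by (rule measurable_compose[OF measurable_vertical_at]) (use assms in auto)
  with measurable_phase[OF assms, of b k]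
  show "integrable M (phase b h k)"
    and "integrable M (\<lambda>\<omega>. phase b h k \<omega> * complex_of_real (flip_sign (vertical (N (real k * h) \<omega>) \<omega>)))"
    by (auto intro!: integrable_const_bound[of _ 1] simp: norm_mult)
qed

lemma norm_phase_mean_le: "norm (phase_mean b h k) \<le> 1"
  and norm_signed_phase_mean_le: "norm (signed_phase_mean b h k) \<le> 1"
  unfolding phase_mean_def signed_phase_mean_def
  by (rule order_trans[OF integral_norm_bound], simp add: norm_mult prob_space)+

text \<open>Cosine is even and sine is odd, so the exponential is affine in a sign. This makes the
  recursion for the two means linear.\<close>

lemma cis_flip_sign:
  "cis (x * flip_sign v) = cos (complex_of_real x) + \<i> * sin (complex_of_real x) * complex_of_real (flip_sign v)"
  by (simp add: flip_sign_def complex_eq_iff cos_of_real sin_of_real)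

lemma phase_Suc:
  "phase b h (Suc k) \<omega> =
    cos (complex_of_real b * of_real h) * phase b h k \<omega> +
    \<i> * sin (complex_of_real b * of_real h) *
      (phase b h k \<omega> * complex_of_real (flip_sign (vertical (N (real k * h) \<omega>) \<omega>)))"
  unfolding phase_def prod.lessThan_Suc cis_flip_sign by (simp add: algebra_simps)

lemma phase_mean_Suc:
  assumes "0 < h"
  shows "phase_mean b h (Suc k) =
    cos (complex_of_real b * of_real h) * phase_mean b h k +
    \<i> * sin (complex_of_real b * of_real h) * signed_phase_mean b h k"
  unfolding phase_mean_def signed_phase_mean_def phase_Suc
  using integrable_phase[of h b k] assms by (subst Bochner_Integration.integral_add) auto

text \<open>The Markov step replaces the newest sign by the one at \<open>real k * h\<close>, at the
  cost of the exponential factor. Splitting off the last phase factor then produces the square of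
  that sign, which is 1, so the recursion closes.\<close>

lemma signed_phase_mean_Suc:
  assumes "0 < h"
  shows "signed_phase_mean b h (Suc k) = exp (- 2 * complex_of_real (rate * (p + q)) * of_real h) *
    (cos (complex_of_real b * of_real h) * signed_phase_mean b h k +
     \<i> * sin (complex_of_real b * of_real h) * phase_mean b h k)"
proof -
  let ?s = "\<lambda>\<omega>. complex_of_real (flip_sign (vertical (N (real k * h) \<omega>) \<omega>))"
  let ?c = "cos (complex_of_real b * of_real h)" and ?d = "\<i> * sin (complex_of_real b * of_real h)"
  define \<Phi> where "\<Phi> l = prod_list (map (\<lambda>v. cis (b * h * flip_sign v)) l)" for l
  have norm: "norm (\<Phi> l) \<le> 1" for l
    unfolding \<Phi>_def by (induction l) (auto simp: norm_mult)
  \<comment> \<open>Sampling at \<open>n\<close> grid points yields \<open>n\<close> phase factors,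
    so the history of length \<open>Suc k\<close> in \<open>vertical_markov\<close> corresponds to
    \<open>phase b h (Suc k)\<close>.\<close>
  have \<Phi>: "\<Phi> (map (\<lambda>i. vertical (N (real i * h) \<omega>) \<omega>) [0..<n]) = phase b h n \<omega>" for n \<omega>
    unfolding \<Phi>_def phase_def by (induction n) auto
  have sq: "?s \<omega> * ?s \<omega> = 1" for \<omega> by (simp add: flip_sign_def)
  have "signed_phase_mean b h (Suc k) = exp (- 2 * (rate * (p + q)) * h) *
      (LINT \<omega>|M. phase b h (Suc k) \<omega> * ?s \<omega>)"
    using vertical_markov[where \<Phi> = \<Phi> and k = k, OF assms norm] unfolding \<Phi> signed_phase_mean_def .
  also have "(LINT \<omega>|M. phase b h (Suc k) \<omega> * ?s \<omega>) =
      (LINT \<omega>|M. ?c * (phase b h k \<omega> * ?s \<omega>) + ?d * phase b h k \<omega>)"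
  proof (rule Bochner_Integration.integral_cong[OF refl])
    fix \<omega>
    show "phase b h (Suc k) \<omega> * ?s \<omega> = ?c * (phase b h k \<omega> * ?s \<omega>) + ?d * phase b h k \<omega>"
      unfolding phase_Suc using sq[of \<omega>] by algebra
  qed
  also have "\<dots> = ?c * signed_phase_mean b h k + ?d * phase_mean b h k"
    unfolding phase_mean_def signed_phase_mean_def
    using integrable_phase[of h b k] assms by (subst Bochner_Integration.integral_add) auto
  finally show ?thesis by (simp flip: exp_of_real)
qed

lemma phase_mean_0: "phase_mean b h 0 = 1"
  by (simp add: phase_mean_def phase_def prob_space)

lemma signed_phase_mean_0: "signed_phase_mean b h 0 = 0"
proof -
  have "signed_phase_mean b h 0 = (LINT \<omega>|M. complex_of_real (flip_sign (odd (J \<omega>))))"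
    unfolding signed_phase_mean_def
    by (rule Bochner_Integration.integral_cong) (simp_all add: phase_def N_zero vertical_def)
  then show ?thesis by (simp only: expectation_flip_initial)
qed

text \<open>The indicator of vertical motion is (1 - S)/2, which gives both the deterministic factor
  and the frequency \<open>- a / 2\<close>. For positive \<open>n\<close> the cells add up to length
  \<open>s\<close>.\<close>

lemma exp_sampled_vertical_time:
  assumes "0 < n"
  shows "exp (\<i> * complex_of_real (a * sampled_vertical_time s n \<omega>)) =
    exp (\<i> * complex_of_real (a / 2) * of_real s) * phase (- a / 2) (s / real n) n \<omega>"
proof -
  let ?v = "\<lambda>k. vertical (N (real k * (s / real n)) \<omega>) \<omega>"
  have of_bool: "of_bool v = (1 - flip_sign v) / 2" for v
    by (simp add: flip_sign_def)
  have "a * sampled_vertical_time s n \<omega> = a * (s / real n) * (real n - (\<Sum>k<n. flip_sign (?v k))) / 2"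
    unfolding sampled_vertical_time_def of_bool by (simp add: sum_subtractf flip: sum_divide_distrib)
  also have "\<dots> = a / 2 * s + (- a / 2) * (s / real n) * (\<Sum>k<n. flip_sign (?v k))"
    using assms by (simp add: field_simps)
  finally have eq: "a * sampled_vertical_time s n \<omega> = a / 2 * s + (\<Sum>k<n. (- a / 2) * (s / real n) * flip_sign (?v k))"
    by (simp only: sum_distrib_left)
  have "phase (- a / 2) (s / real n) n \<omega> = exp (\<i> * complex_of_real (\<Sum>k<n. (- a / 2) * (s / real n) * flip_sign (?v k)))"
    unfolding phase_def cis_conv_exp by (simp add: sum_distrib_left flip: exp_sum)
  then show ?thesis
    unfolding eq by (simp add: exp_add[symmetric] algebra_simps)
qed

text \<open>The sampled times converge path by path and the integrands have modulus 1, so dominated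
  convergence applies.\<close>

lemma phase_mean_tendsto:
  assumes "0 < s"
  shows "(\<lambda>n. exp (\<i> * complex_of_real (a / 2) * of_real s) * phase_mean (- a / 2) (s / real n) n)
    \<longlonglongrightarrow> (LINT \<omega>|M. exp (\<i> * complex_of_real (a * vertical_time N J \<xi> s \<omega>)))"
proof (rule Lim_transform_eventually)
  have meas: "(\<lambda>\<omega>. sampled_vertical_time s n \<omega>) \<in> borel_measurable M" for n
  proof -
    have "(\<lambda>\<omega>. of_bool (vertical (N (real k * (s / real n)) \<omega>) \<omega>) :: real) \<in> borel_measurable M" for k
      by (rule measurable_compose[OF measurable_vertical_at]) (use assms in auto)
    then show ?thesis unfolding sampled_vertical_time_def by measurable
  qed
  show "(\<lambda>n. LINT \<omega>|M. exp (\<i> * complex_of_real (a * sampled_vertical_time s n \<omega>)))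
    \<longlonglongrightarrow> (LINT \<omega>|M. exp (\<i> * complex_of_real (a * vertical_time N J \<xi> s \<omega>)))"
  proof (rule integral_dominated_convergence[where w = "\<lambda>_. 1"])
    show 1: "(\<lambda>\<omega>. exp (\<i> * complex_of_real (a * sampled_vertical_time s n \<omega>))) \<in> borel_measurable M" for n
      using meas[of n] by measurable
    \<comment> \<open>Measurability of the vertical time itself comes from its being a pointwise
      limit of the samples.\<close>
    have "(\<lambda>\<omega>. vertical_time N J \<xi> s \<omega>) \<in> borel_measurable M"
      by (rule borel_measurable_LIMSEQ_real[OF sampled_vertical_time_tendsto[OF assms] meas])
    then show "(\<lambda>\<omega>. exp (\<i> * complex_of_real (a * vertical_time N J \<xi> s \<omega>))) \<in> borel_measurable M"
      by measurable
    show "AE \<omega> in M. (\<lambda>n. exp (\<i> * complex_of_real (a * sampled_vertical_time s n \<omega>)))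
        \<longlonglongrightarrow> exp (\<i> * complex_of_real (a * vertical_time N J \<xi> s \<omega>))"
      by (rule AE_I2) (intro tendsto_intros sampled_vertical_time_tendsto assms)
    show "AE \<omega> in M. norm (exp (\<i> * complex_of_real (a * sampled_vertical_time s n \<omega>))) \<le> 1" for n
      by (rule AE_I2) (simp add: norm_exp_i_times)
  qed simp
  have "(LINT \<omega>|M. exp (\<i> * complex_of_real (a * sampled_vertical_time s n \<omega>))) =
      exp (\<i> * complex_of_real (a / 2) * of_real s) * phase_mean (- a / 2) (s / real n) n" if "0 < n" for n
    unfolding exp_sampled_vertical_time[OF that] phase_mean_def by simp
  then show "\<forall>\<^sub>F n in sequentially. (LINT \<omega>|M. exp (\<i> * complex_of_real (a * sampled_vertical_time s n \<omega>))) =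
      exp (\<i> * complex_of_real (a / 2) * of_real s) * phase_mean (- a / 2) (s / real n) n"
    by (intro eventually_sequentiallyI[of 1]) simp
qed

text \<open>The roots of the characteristic equation are \<open>g - \<mu>\<close> and
  \<open>- g - \<mu>\<close>, and the bound on \<open>Re g\<close> puts both in the closed left
  half-plane. Each root gives the limit of one combination of \<open>u\<close> and \<open>w\<close>;
  eliminating \<open>w\<close> divides by \<open>b\<close> and \<open>g\<close>, whence the
  conditions that \<open>a\<close> and \<open>g\<close> be nonzero.\<close>

lemma characteristic_function_vertical_time:
  assumes s: "0 < s" and a: "a \<noteq> 0" and g: "g\<^sup>2 = complex_of_real ((rate * (p + q))\<^sup>2 - (a / 2)\<^sup>2)"
    and g0: "g \<noteq> 0" and Re_g: "\<bar>Re g\<bar> \<le> rate * (p + q)"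
  defines "\<mu> \<equiv> complex_of_real (rate * (p + q))"
  shows "(LINT \<omega>|M. exp (\<i> * complex_of_real (a * vertical_time N J \<xi> s \<omega>))) =
    exp (\<i> * complex_of_real (a / 2) * of_real s) *
      ((1 + \<mu> / g) / 2 * exp ((g - \<mu>) * of_real s) + (1 - \<mu> / g) / 2 * exp ((- g - \<mu>) * of_real s))"
proof -
  define b where "b = complex_of_real (- a / 2)"
  define u where "u n k = phase_mean (- a / 2) (s / real n) k" for n k
  define w where "w n k = signed_phase_mean (- a / 2) (s / real n) k" for n k
  define E where "E \<kappa> = exp (\<kappa> * complex_of_real s)" for \<kappa>
  have g2: "g\<^sup>2 = \<mu>\<^sup>2 - b\<^sup>2" unfolding g \<mu>_def b_def by (simp add: power_divide)
  have b0: "b \<noteq> 0" using a by (simp add: b_def)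
  have lim: "(\<lambda>n. \<i> * b * u n n + \<kappa> * w n n) \<longlonglongrightarrow> \<i> * b * E \<kappa>"
    if "\<kappa>\<^sup>2 + 2 * \<mu> * \<kappa> + b\<^sup>2 = 0" "Re \<kappa> \<le> 0" for \<kappa>
    unfolding E_def
  proof (rule telegraph_recursion_limit[where u = u and w = w and \<beta> = b and \<mu> = \<mu>, OF s])
    show "u n (Suc k) = cos (b * of_real (s / real n)) * u n k + \<i> * sin (b * of_real (s / real n)) * w n k"
      if "0 < n" for n k
      unfolding u_def w_def b_def using phase_mean_Suc[of "s / real n" "- a / 2" k] s that by simp
    show "w n (Suc k) = exp (- 2 * \<mu> * of_real (s / real n)) *
        (cos (b * of_real (s / real n)) * w n k + \<i> * sin (b * of_real (s / real n)) * u n k)"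
      if "0 < n" for n k
      unfolding u_def w_def b_def \<mu>_def using signed_phase_mean_Suc[of "s / real n" "- a / 2" k] s that by simp
  qed (use that in \<open>simp_all add: u_def w_def phase_mean_0 signed_phase_mean_0
      norm_phase_mean_le norm_signed_phase_mean_le\<close>)
  have plus: "(\<lambda>n. \<i> * b * u n n + (g - \<mu>) * w n n) \<longlonglongrightarrow> \<i> * b * E (g - \<mu>)"
  proof (rule lim)
    show "(g - \<mu>)\<^sup>2 + 2 * \<mu> * (g - \<mu>) + b\<^sup>2 = 0" using g2 by algebra
    show "Re (g - \<mu>) \<le> 0" using Re_g by (simp add: \<mu>_def)
  qed
  have minus: "(\<lambda>n. \<i> * b * u n n + (- g - \<mu>) * w n n) \<longlonglongrightarrow> \<i> * b * E (- g - \<mu>)"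
  proof (rule lim)
    show "(- g - \<mu>)\<^sup>2 + 2 * \<mu> * (- g - \<mu>) + b\<^sup>2 = 0" using g2 by algebra
    show "Re (- g - \<mu>) \<le> 0" using Re_g by (simp add: \<mu>_def)
  qed
  \<comment> \<open>The weights \<open>g + \<mu>\<close> and \<open>g - \<mu>\<close> cancel the
    coefficient of \<open>w\<close> and sum to \<open>2 * g\<close>, so the numerator is
    \<open>2 * \<i> * b * g\<close> times \<open>u n n\<close>.\<close>
  have "(\<lambda>n. ((g + \<mu>) * (\<i> * b * u n n + (g - \<mu>) * w n n) + (g - \<mu>) * (\<i> * b * u n n + (- g - \<mu>) * w n n)) /
        (2 * \<i> * b * g))
      \<longlonglongrightarrow> ((g + \<mu>) * (\<i> * b * E (g - \<mu>)) + (g - \<mu>) * (\<i> * b * E (- g - \<mu>))) / (2 * \<i> * b * g)"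
    by (intro tendsto_intros plus minus) (use b0 g0 in simp)
  moreover have "((g + \<mu>) * (\<i> * b * U + (g - \<mu>) * W) + (g - \<mu>) * (\<i> * b * U + (- g - \<mu>) * W)) /
      (2 * \<i> * b * g) = U" for U W
    using b0 g0 by (simp add: field_simps)
  moreover have "((g + \<mu>) * (\<i> * b * X) + (g - \<mu>) * (\<i> * b * Y)) / (2 * \<i> * b * g) =
      (1 + \<mu> / g) / 2 * X + (1 - \<mu> / g) / 2 * Y" for X Y
    using b0 g0 by (simp add: field_simps)
  ultimately have "(\<lambda>n. u n n) \<longlonglongrightarrow> (1 + \<mu> / g) / 2 * E (g - \<mu>) + (1 - \<mu> / g) / 2 * E (- g - \<mu>)"
    by simp
  from LIMSEQ_unique[OF phase_mean_tendsto[OF s] tendsto_mult_left[OF this[unfolded u_def]]]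
  show ?thesis by (simp add: E_def)
qed

end

text \<open>The formula divides by the square root, so the radicand is taken to be nonzero.
  Replacing \<open>r\<close> by \<open>- r\<close> swaps the two summands, so the branch chosen by
  \<open>csqrt\<close> does not affect the value.\<close>

theorem theorem9:
  fixes M :: "'a measure" and N :: "real \<Rightarrow> 'a \<Rightarrow> nat" and J :: "'a \<Rightarrow> int"
    and \<xi> :: "nat \<Rightarrow> 'a \<Rightarrow> int" and lam p q t \<alpha> :: real
  assumes "direction_process M lam N p q J \<xi>"
    and "0 < t"
    and "4 * lam\<^sup>2 * (p + q)\<^sup>2 - \<alpha>\<^sup>2 \<noteq> 0"
  shows "(LINT \<omega>|M. exp (\<i> * complex_of_real (\<alpha> * vertical_time N J \<xi> t \<omega>))) =
    (let r = csqrt (complex_of_real (4 * lam\<^sup>2 * (p + q)\<^sup>2 - \<alpha>\<^sup>2));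
         m = complex_of_real (lam * (p + q))
     in 1/2 * (1 + 2 * m / r) * exp (\<i> * (\<alpha> / 2) * t - m * t + 1/2 * r * t)
      + 1/2 * (1 - 2 * m / r) * exp (\<i> * (\<alpha> / 2) * t - m * t - 1/2 * r * t))"
proof -
  interpret direction_process M lam N p q J \<xi> by fact
  define m where "m = lam * (p + q)"
  define D where "D = 4 * lam\<^sup>2 * (p + q)\<^sup>2 - \<alpha>\<^sup>2"
  define r where "r = csqrt (complex_of_real D)"
  have D: "D = 4 * m\<^sup>2 - \<alpha>\<^sup>2" by (simp add: D_def m_def power_mult_distrib)
  have m0: "0 \<le> m" using rate_pos turn_probs by (simp add: m_def)
  have r2: "r\<^sup>2 = complex_of_real D" by (simp add: r_def)
  have r0: "r \<noteq> 0" using assms(3) unfolding r_def D_def[symmetric] by simp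
  have "(LINT \<omega>|M. exp (\<i> * complex_of_real (\<alpha> * vertical_time N J \<xi> t \<omega>))) =
      1/2 * (1 + 2 * m / r) * exp (\<i> * (\<alpha> / 2) * t - m * t + 1/2 * r * t)
      + 1/2 * (1 - 2 * m / r) * exp (\<i> * (\<alpha> / 2) * t - m * t - 1/2 * r * t)"
  proof (cases "\<alpha> = 0")
    \<comment> \<open>The elimination of \<open>w\<close> divides by \<alpha>, so \<alpha> = 0 is
      separate: the mean is 1 and \<open>r = 2 * m\<close>, which kills the second coefficient and
      makes the first exponential 1.\<close>
    case True
    then have "r = complex_of_real (sqrt D)"
      using csqrt_of_real_nonneg[of "complex_of_real D"] by (simp add: r_def D)
    also have "sqrt D = 2 * m"
      using True m0 by (simp add: D real_sqrt_mult)
    finally have "r = 2 * m" by simp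
    with True r0 show ?thesis by (simp add: prob_space)
  next
    case False
    \<comment> \<open>A nonnegative radicand is at most \<open>4 * m\<^sup>2\<close>, and a negative
      one has a purely imaginary root.\<close>
    have Re_r: "\<bar>Re r\<bar> \<le> 2 * m"
    proof (cases "0 \<le> D")
      case True
      then have "r = complex_of_real (sqrt D)"
        using csqrt_of_real_nonneg[of "complex_of_real D"] by (simp add: r_def)
      moreover have "sqrt D \<le> 2 * m"
        using m0 by (intro real_le_lsqrt) (simp_all add: D power_mult_distrib)
      ultimately show ?thesis using True by simp
    next
      case False
      then have "r = \<i> * sqrt \<bar>D\<bar>"
        using csqrt_of_real_nonpos[of "complex_of_real D"] by (simp add: r_def)
      then show ?thesis using m0 by simp
    qed
    \<comment> \<open>The root to insert is \<open>r / 2\<close>, since a quarter of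
      \<open>D\<close> is \<open>m\<^sup>2 - (\<alpha> / 2)\<^sup>2\<close>.\<close>
    have "(LINT \<omega>|M. exp (\<i> * complex_of_real (\<alpha> * vertical_time N J \<xi> t \<omega>))) =
        exp (\<i> * complex_of_real (\<alpha> / 2) * of_real t) *
        ((1 + complex_of_real m / (r / 2)) / 2 * exp ((r / 2 - complex_of_real m) * of_real t) +
         (1 - complex_of_real m / (r / 2)) / 2 * exp ((- (r / 2) - complex_of_real m) * of_real t))"
      unfolding m_def
    proof (rule characteristic_function_vertical_time[OF \<open>0 < t\<close> False])
      show "(r / 2)\<^sup>2 = complex_of_real ((lam * (p + q))\<^sup>2 - (\<alpha> / 2)\<^sup>2)"
        unfolding power_divide r2 by (simp add: D m_def field_simps)
      show "r / 2 \<noteq> 0" using r0 by simp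
      show "\<bar>Re (r / 2)\<bar> \<le> lam * (p + q)" using Re_r by (simp add: m_def)
    qed
    also have "\<dots> = 1/2 * (1 + 2 * m / r) * exp (\<i> * (\<alpha> / 2) * t - m * t + 1/2 * r * t)
      + 1/2 * (1 - 2 * m / r) * exp (\<i> * (\<alpha> / 2) * t - m * t - 1/2 * r * t)"
    proof -
      have "exp (\<i> * complex_of_real (\<alpha> / 2) * of_real t) * exp ((r / 2 - complex_of_real m) * of_real t) =
          exp (\<i> * (\<alpha> / 2) * t - m * t + 1/2 * r * t)"
        and "exp (\<i> * complex_of_real (\<alpha> / 2) * of_real t) * exp ((- (r / 2) - complex_of_real m) * of_real t) =
          exp (\<i> * (\<alpha> / 2) * t - m * t - 1/2 * r * t)"
        unfolding exp_add[symmetric] by (simp_all add: algebra_simps)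
      then show ?thesis
        by (simp only: distrib_left mult.left_commute[of "exp (\<i> * complex_of_real (\<alpha> / 2) * of_real t)"])
          (simp add: field_simps)
    qed
    finally show ?thesis .
  qed
  then show ?thesis by (simp only: Let_def r_def D_def m_def of_real_mult of_real_numeral mult.assoc)
qed

end
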